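(* Let $r_j$ be a sequence of primes with $r_j\to\infty$. For each $j$ let $q_j$ be a generator of the multiplicative group of the field $\mathbb{Z}/r_j\mathbb{Z}$, let $H_j\ge r_j$ be an integer, and put $$s_j(i)=H_j+\{q_j^{\,i}\}-\{q_j^{\,i+1}\},\qquad i=1,2,\dots,r_j-1,$$ where $\{q\}$ denotes the element of $\{1,2,\dots,r_j-1\}$ representing the nonzero residue $q$ modulo $r_j$; let $s_j(r_j)\ge 0$ be an arbitrary integer. Let $T$ be the rank one construction with cuttings $r_j$ and spacers $(s_j(1),\dots,s_j(r_j))$, and suppose that the resulting measure space $(X,\mu)$ has infinite measure. Then $T$ is mixing.
   Context: Rank one construction: it is determined by $h_1$, a sequence of integers $r_j$ (cuttings), and a sequence of spacer vectors $(s_j(1),\dots,s_j(r_j))$ of nonnegative integers. At step $j$ one has a tower of disjoint sets (intervals of equal finite measure) $E_j,TE_j,\dots,T^{h_j}E_j$, on which $T$ is defined except on the top level. Cut $E_j$ into $r_j$ subintervals $E_j^1,\dots,E_j^{r_j}$ of equal measure, giving columns $E_j^i,TE_j^i,\dots,T^{h_j}E_j^i$. Above the $i$-th column add $s_j(i)$ new disjoint intervals (spacers) of the same measure as $E_j^i$, giving $E_j^i,TE_j^i,\dots,T^{h_j+s_j(i)}E_j^i$, and for $i<r_j$ set $T\,T^{h_j+s_j(i)}E_j^i=E_j^{i+1}$. This gives the tower $E_{j+1},TE_{j+1},\dots,T^{h_{j+1}}E_{j+1}$ with $E_{j+1}=E_j^1$ and $h_{j+1}+1=(h_j+1)r_j+\sum_{i=1}^{r_j}s_j(i)$.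 The space $X$ is the union of all the towers, $\mu$ is Lebesgue measure on it, and $T$ is the resulting invertible measure-preserving transformation. Mixing (infinite measure): for any $\varepsilon>0$ and any sets $A,B$ of finite measure there is $N$ such that $\mu(T^kA\cap B)<\varepsilon$ for all $|k|>N$. *)

theory Defs
  imports
    "HOL-Analysis.Analysis"
    "HOL-Number_Theory.Residues"
    "HOL-Algebra.Generated_Groups"
begin

(* Stages are indexed from 0, so the parameter h1 is the value at stage 0.
   The tower of stage j has the height j + 1 levels 0, ..., height j.
   Columns, as well as the entries of a spacer vector, are indexed from 1 to r j. *)

primrec height :: "nat \<Rightarrow> (nat \<Rightarrow> nat) \<Rightarrow> (nat \<Rightarrow> nat \<Rightarrow> nat) \<Rightarrow> nat \<Rightarrow> nat" where
  "height h1 r s 0 = h1"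
| "height h1 r s (Suc j) = (height h1 r s j + 1) * r j + (\<Sum>i=1..r j. s j i) - 1"

(* The level of the tower of stage j + 1 at which the i-th column of stage j starts. *)
definition column_base ::
  "nat \<Rightarrow> (nat \<Rightarrow> nat) \<Rightarrow> (nat \<Rightarrow> nat \<Rightarrow> nat) \<Rightarrow> nat \<Rightarrow> nat \<Rightarrow> nat" where
  "column_base h1 r s j i = (\<Sum>l=1..<i. height h1 r s j + 1 + s j l)"

(* w j is the common length of the levels of stage j, a j k the left end point of level k. *)
definition level :: "(nat \<Rightarrow> real) \<Rightarrow> (nat \<Rightarrow> nat \<Rightarrow> real) \<Rightarrow> nat \<Rightarrow> nat \<Rightarrow> real set" where
  "level w a j k = {a j k ..< a j k + w j}"

(* Half-open intervals, cut from left to right, make T defined at every point of the union of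
   the towers: no point lies in the top level of every late stage when the widths tend to 0.
   Positions of the spacers on the real line are arbitrary. That they are new, i.e. disjoint
   from the tower of stage j, is part of disjointness at stage j + 1, since each level of
   stage j is the union of its pieces, which are levels of stage j + 1. *)
locale rank_one_construction =
  fixes h1 :: nat
    and r :: "nat \<Rightarrow> nat"
    and s :: "nat \<Rightarrow> nat \<Rightarrow> nat"
    and w :: "nat \<Rightarrow> real"
    and a :: "nat \<Rightarrow> nat \<Rightarrow> real"
    and T :: "real \<Rightarrow> real"
  assumes cuts_pos: "r j > 0"
    and width_pos: "w 0 > 0"
    and width_Suc: "w (Suc j) = w j / real (r j)"
    and disjoint_levels: "disjoint_family_on (level w a j) {0..height h1 r s j}"
    and cut: "\<lbrakk>i \<in> {1..r j}; k \<le> height h1 r s j\<rbrakk> \<Longrightarrow>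
      a (Suc j) (column_base h1 r s j i + k) = a j k + real (i - 1) * w (Suc j)"
    and translate: "\<lbrakk>k < height h1 r s j; x \<in> level w a j k\<rbrakk> \<Longrightarrow>
      T x = x + (a j (Suc k) - a j k)"

definition rank_one_space ::
  "nat \<Rightarrow> (nat \<Rightarrow> nat) \<Rightarrow> (nat \<Rightarrow> nat \<Rightarrow> nat) \<Rightarrow> (nat \<Rightarrow> real) \<Rightarrow> (nat \<Rightarrow> nat \<Rightarrow> real) \<Rightarrow> real measure"
where
  "rank_one_space h1 r s w a =
     restrict_space lebesgue (\<Union>j. \<Union>k\<in>{0..height h1 r s j}. level w a j k)"

(* T is invertible only up to null sets (for a rank one construction with widths tending to 0
   the left end point of the bottom level has no preimage), so negative powers of T
   act on sets by preimage. *)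
definition power_set :: "'a measure \<Rightarrow> ('a \<Rightarrow> 'a) \<Rightarrow> int \<Rightarrow> 'a set \<Rightarrow> 'a set" where
  "power_set M T k A =
     (if k \<ge> 0 then (T ^^ nat k) ` A else (T ^^ nat (- k)) -` A \<inter> space M)"

definition infinite_measure_mixing :: "'a measure \<Rightarrow> ('a \<Rightarrow> 'a) \<Rightarrow> bool" where
  "infinite_measure_mixing M T \<longleftrightarrow>
     (\<forall>\<epsilon>::real. \<epsilon> > 0 \<longrightarrow> (\<forall>A\<in>sets M. \<forall>B\<in>sets M.
        emeasure M A < \<infinity> \<longrightarrow> emeasure M B < \<infinity> \<longrightarrow>
        (\<exists>N::nat. \<forall>k::int. \<bar>k\<bar> > int N \<longrightarrow> emeasure M (power_set M T k A \<inter> B) < ennreal \<epsilon>)))"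

(* The elements of residue_ring p are the integers 0, ..., p - 1. *)
definition generates_residue_units :: "int \<Rightarrow> int \<Rightarrow> bool" where
  "generates_residue_units p q \<longleftrightarrow>
     q \<in> carrier (mult_of (residue_ring p)) \<and>
     generate (mult_of (residue_ring p)) {q} = carrier (mult_of (residue_ring p))"

end

theory Submission
  imports Defs
begin

text \<open>
  For a return at time \<open>m\<close> from the tower of a fixed stage \<open>n\<close> to itself, let \<open>j\<close> be the stage whose
  number of levels is at most \<open>m\<close> while that of stage \<open>j + 1\<close> exceeds \<open>m\<close>. Apart
  from a small set, such a return moves a point from a column of a stage to a different column,
  \<open>d > 0\<close> columns further. The spacer vector
  telescopes: the starting levels of columns \<open>i\<close> and \<open>i + d\<close> differ by a constant depending on \<open>d\<close>
  plus \<open>q ^ i mod r - q ^ (i + d) mod r\<close>. As a function of \<open>i\<close> this difference is injective, since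
  modulo \<open>r\<close> it is the multiple of \<open>q ^ i\<close> by the invertible \<open>1 - q ^ d\<close> (unless
  \<open>d = r - 1\<close>, when only one column \<open>i\<close> is left), and it lies between \<open>- r\<close> and \<open>r\<close>. So when the column of departure varies and the height in it is fixed, the heights of arrival
  are distinct points of a window of length \<open>2 * r\<close>
  (\<open>shifted_residue_differences_inj\<close>, \<open>card_cross_returns_le\<close>).

  Only the heights inside the tower of stage \<open>n\<close> count as returns, and these have small density in
  long windows. Indeed the measure is infinite, so the tower of stage \<open>n\<close> fills a small part of the
  tower of some intermediate stage, and copies of the intermediate tower do not overlap
  (\<open>window_density_small\<close>). It suffices to follow a return up to stage \<open>j + 2\<close>: it crosses columns of
  stage \<open>j\<close>, or crosses columns of stage \<open>j + 1\<close>, or starts in the last column of stage \<open>j + 1\<close>, and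
  the last possibility has relative measure \<open>1 / r (j + 1)\<close> (\<open>emeasure_tower_returns_le\<close>).

  Towers exhaust the space, and neither images nor preimages under \<open>T\<close> increase measure, so mixing
  for arbitrary sets of finite measure follows (\<open>mixing_if_towers_return_little\<close>).
\<close>

section \<open>Spacers from a generator of the residue field\<close>

lemma generator_power_neq_one:
  fixes g :: int
  assumes "prime p" "generates_residue_units (int p) g" "0 < e" "e < p - 1"
  shows "\<not> [g ^ e = 1] (mod int p)"
proof
  assume one: "[g ^ e = 1] (mod int p)"
  interpret residues_prime p "residue_ring (int p)"
    by unfold_locales (use assms in auto)
  interpret field "residue_ring (int p)"
    by (rule is_field)
  interpret G: group "mult_of (residue_ring (int p))"
    by (rule field_mult_group)
  have g: "g \<in> carrier (mult_of (residue_ring (int p)))"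
    and gen: "generate (mult_of (residue_ring (int p))) {g} = carrier (mult_of (residue_ring (int p)))"
    using assms(2) by (auto simp: generates_residue_units_def)
  have "g \<in> carrier (residue_ring (int p))"
    using g by simp
  then have "g mod int p = g"
    by (simp add: res_carrier_eq)
  then have "g [^]\<^bsub>residue_ring (int p)\<^esub> e = g ^ e mod int p"
    using pow_cong[of g e] by simp
  also have "\<dots> = 1"
    using one m_gt_one by (simp add: cong_def)
  finally have "g [^]\<^bsub>mult_of (residue_ring (int p))\<^esub> e = \<one>\<^bsub>mult_of (residue_ring (int p))\<^esub>"
    by (simp add: nat_pow_mult_of res_one_eq)
  then have "G.ord g dvd e"
    using G.pow_eq_id[OF g] by simp
  then have "G.ord g \<le> e"
    using assms(3) by (rule dvd_imp_le)
  moreover have "G.ord g = p - 1"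
  proof -
    have "carrier (mult_of (residue_ring (int p))) = {1..int p - 1}"
      by (auto simp: res_carrier_eq res_zero_eq)
    then show ?thesis
      using G.generate_pow_card[OF g] gen by simp
  qed
  ultimately show False
    using assms(4) by simp
qed

lemma generator_coprime:
  assumes "prime p" "generates_residue_units (int p) g"
  shows "coprime g (int p)"
proof -
  interpret residues_prime p "residue_ring (int p)"
    by unfold_locales (use assms in auto)
  have "g \<in> {1..int p - 1}"
    using assms(2) by (auto simp: generates_residue_units_def res_carrier_eq res_zero_eq)
  then show ?thesis
    by (auto simp: p_coprime_right_int zdvd_not_zless)
qed

lemma generator_powers_distinct:
  assumes "prime p" "generates_residue_units (int p) g" "x < y" "y < x + (p - 1)"
  shows "\<not> [g ^ y = g ^ x] (mod int p)"
proof
  assume "[g ^ y = g ^ x] (mod int p)"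
  then have "[g ^ x * g ^ (y - x) = g ^ x * 1] (mod int p)"
    using assms(3) by (simp flip: power_add)
  then have "[g ^ (y - x) = 1] (mod int p)"
    using generator_coprime[OF assms(1,2)] cong_mult_lcancel[of "g ^ x" "int p" "g ^ (y - x)" 1]
    by (simp del: mult_1_right)
  then show False
    using generator_power_neq_one[OF assms(1,2), of "y - x"] assms(3,4) by simp
qed

text \<open>Modulo the prime, the difference equals \<open>g ^ i * (1 - g ^ d)\<close>, and \<open>1 - g ^ d\<close> is invertible
  unless \<open>d\<close> is a multiple of \<open>p - 1\<close>; in the range considered this leaves \<open>d = p - 1\<close>, where the
  set of admissible \<open>i\<close> has at most one element.\<close>

lemma shifted_residue_differences_inj:
  assumes "prime p" "generates_residue_units (int p) g" "0 < d"
  shows "inj_on (\<lambda>i. g ^ i mod int p - g ^ (i + d) mod int p) {1..p - d}"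
proof -
  have False
    if xy: "x \<in> {1..p - d}" "y \<in> {1..p - d}" "x < y"
      and eq: "g ^ x mod int p - g ^ (x + d) mod int p = g ^ y mod int p - g ^ (y + d) mod int p"
    for x y
  proof -
    have "[g ^ x - g ^ (x + d) = g ^ y - g ^ (y + d)] (mod int p)"
      using arg_cong[OF eq, of "\<lambda>z. z mod int p"] by (simp add: cong_def mod_diff_eq)
    then have "int p dvd (g ^ x - g ^ y) * (1 - g ^ d)"
      by (simp add: cong_iff_dvd_diff algebra_simps power_add)
    then have "int p dvd g ^ x - g ^ y \<or> int p dvd 1 - g ^ d"
      using assms(1) by (simp add: prime_dvd_mult_iff)
    then have "[g ^ y = g ^ x] (mod int p) \<or> [g ^ d = 1] (mod int p)"
      by (auto simp: cong_iff_dvd_diff dvd_diff_commute)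
    then show False
      using generator_powers_distinct[OF assms(1,2), of x y]
        generator_power_neq_one[OF assms(1,2,3)] xy assms(3) by auto
  qed
  then show ?thesis
    by (intro linorder_inj_onI') metis
qed

section \<open>Stacking the columns of one stage\<close>

definition column_start :: "nat \<Rightarrow> (nat \<Rightarrow> nat) \<Rightarrow> nat \<Rightarrow> nat" where
  "column_start L s i = (\<Sum>l=1..<i. L + s l)"

definition stack :: "nat \<Rightarrow> (nat \<Rightarrow> nat) \<Rightarrow> nat \<Rightarrow> nat set \<Rightarrow> nat set" where
  "stack L s r S = (\<Union>i\<in>{1..r}. (+) (column_start L s i) ` S)"

lemma stackE:
  assumes "p \<in> stack L s r S"
  obtains i k where "1 \<le> i" "i \<le> r" "k \<in> S" "p = column_start L s i + k"
  using assms by (auto simp: stack_def)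

lemma column_start_1 [simp]: "column_start L s (Suc 0) = 0"
  by (simp add: column_start_def)

lemma column_start_split:
  assumes "1 \<le> i" "i \<le> i'"
  shows "column_start L s i' = column_start L s i + (\<Sum>l=i..<i'. L + s l)"
  unfolding column_start_def using assms by (simp add: sum.atLeastLessThan_concat)

lemma column_start_less:
  assumes "1 \<le> i" "i < i'"
  shows "column_start L s i + L + s i \<le> column_start L s i'"
proof -
  have "(\<Sum>l=i..<Suc i. L + s l) \<le> (\<Sum>l=i..<i'. L + s l)"
    by (rule sum_mono2) (use assms in auto)
  then show ?thesis
    using column_start_split[of i i' L s] assms by simp
qed

lemma column_index_le:
  assumes "1 \<le> i'" "k' < L" "column_start L s i + k \<le> column_start L s i' + k'"
  shows "i \<le> i'"
  using column_start_less[of i' i L s] assms by linarith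

lemma finite_stack: "finite S \<Longrightarrow> finite (stack L s r S)"
  by (simp add: stack_def)

lemma card_stack_le:
  assumes "finite S"
  shows "card (stack L s r S) \<le> r * card S"
proof -
  have "card (stack L s r S) \<le> (\<Sum>i\<in>{1..r}. card ((+) (column_start L s i) ` S))"
    unfolding stack_def by (rule card_UN_le) simp
  also have "\<dots> \<le> (\<Sum>i\<in>{1..r}. card S)"
    by (intro sum_mono card_image_le assms)
  finally show ?thesis by simp
qed

lemma stack_bound:
  assumes "S \<subseteq> {..<L}"
  shows "stack L s r S \<subseteq> {..<column_start L s (r + 1)}"
proof
  fix p assume "p \<in> stack L s r S"
  then obtain i k where "1 \<le> i" "i \<le> r" "k \<in> S" "p = column_start L s i + k"
    by (rule stackE)
  then show "p \<in> {..<column_start L s (r + 1)}"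
    using column_start_less[of i "r + 1" L s] assms by fastforce
qed

lemma stack_UN: "stack L s r (\<Union>b\<in>B. (+) b ` S) = (\<Union>b\<in>stack L s r B. (+) b ` S)"
  by (auto simp: stack_def image_UN image_image add.assoc)

text \<open>The spacer vector telescopes: between two columns the residues cancel except for the first
  and the last, so the offset is an arithmetic progression up to an error smaller than \<open>r\<close>.\<close>

lemma column_start_telescope:
  fixes H :: int
  assumes s: "\<And>i. i \<in> {1..r - 1} \<Longrightarrow>
      int (s i) = H + g ^ i mod int r - g ^ (i + 1) mod int r"
    and "1 \<le> i" "i + d \<le> r"
  shows "int (column_start L s (i + d)) =
    int (column_start L s i) + int d * (int L + H) + (g ^ i mod int r - g ^ (i + d) mod int r)"
  using assms(3)
proof (induction d)
  case (Suc d)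
  have "column_start L s (i + Suc d) = column_start L s (i + d) + (L + s (i + d))"
    using column_start_split[of "i + d" "i + Suc d" L s] assms(2) by simp
  then show ?case
    using Suc s[of "i + d"] assms(2) by (simp add: algebra_simps le_diff_conv2)
qed simp

definition cross_returns :: "nat \<Rightarrow> (nat \<Rightarrow> nat) \<Rightarrow> nat \<Rightarrow> nat set \<Rightarrow> nat \<Rightarrow> nat set" where
  "cross_returns L s r S m = {p. \<exists>i i' k k'. 1 \<le> i \<and> i < i' \<and> i' \<le> r \<and> k \<in> S \<and> k' \<in> S \<and>
     p = column_start L s i + k \<and> p + m = column_start L s i' + k'}"

text \<open>Fix the displacement \<open>d\<close> of the column index and the starting height \<open>k\<close>. The landing heights
  reached from the various columns are pairwise distinct and lie in a window of length \<open>2 * r\<close>,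
  so at most \<open>c\<close> columns qualify. Since the columns are spaced by \<open>L + H \<ge> L + r\<close> up to an error
  below \<open>r\<close>, only two displacements are compatible with the time \<open>m\<close>.\<close>

lemma card_cross_returns_le:
  fixes H :: int
  assumes prime: "prime r" and gen: "generates_residue_units (int r) g"
    and H: "H \<ge> int r"
    and s: "\<And>i. i \<in> {1..r - 1} \<Longrightarrow>
      int (s i) = H + g ^ i mod int r - g ^ (i + 1) mod int r"
    and S: "S \<subseteq> {..<L}"
    and window: "\<And>u. card (S \<inter> {u..<u + 2 * r}) \<le> c"
  shows "card (cross_returns L s r S m) \<le> 2 * card S * c"
proof -
  have finS: "finite S"
    using S finite_subset by blast
  have r0: "r > 0"
    using prime by (simp add: prime_gt_0_nat)
  define M where "M = int L + H"
  define \<delta> where "\<delta> d i = g ^ i mod int r - g ^ (i + d) mod int r" for d i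
  have M0: "M > 0"
    using H r0 by (simp add: M_def)
  have \<delta>_bound: "\<bar>\<delta> d i\<bar> < int r" for d i
  proof -
    have "0 \<le> g ^ i mod int r" "g ^ i mod int r < int r"
      "0 \<le> g ^ (i + d) mod int r" "g ^ (i + d) mod int r < int r"
      using r0 by simp_all
    then show ?thesis
      unfolding \<delta>_def by linarith
  qed
  \<comment> \<open>If a column displacement \<open>d\<close> is possible, then \<open>d * M\<close> is within \<open>M\<close> of \<open>m\<close>.\<close>
  define D where "D = {nat (int m div M), nat (int m div M) + 1}"
  define I where
    "I d k = {i \<in> {1..r - d}. \<exists>k'\<in>S. int k' = int k + int m - int d * M - \<delta> d i}" for d k
  have card_I: "card (I d k) \<le> c" if "0 < d" for d k
  proof -
    define z where "z = int k + int m - int d * M"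
    have inj: "inj_on (\<lambda>i. nat (z - \<delta> d i)) (I d k)"
    proof (rule inj_onI)
      fix x y assume x: "x \<in> I d k" and y: "y \<in> I d k" and eq: "nat (z - \<delta> d x) = nat (z - \<delta> d y)"
      from x y obtain k1 k2 where "int k1 = z - \<delta> d x" "int k2 = z - \<delta> d y"
        by (auto simp: I_def z_def)
      then have "z - \<delta> d x \<ge> 0" "z - \<delta> d y \<ge> 0"
        by linarith+
      then have "\<delta> d x = \<delta> d y"
        using eq by (simp add: eq_nat_nat_iff)
      then show "x = y"
        using shifted_residue_differences_inj[OF prime gen that] x y
        by (auto simp: \<delta>_def I_def dest: inj_onD)
    qed
    have "(\<lambda>i. nat (z - \<delta> d i)) ` I d k \<subseteq> S \<inter> {nat (z - int r)..<nat (z - int r) + 2 * r}"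
    proof
      fix p assume "p \<in> (\<lambda>i. nat (z - \<delta> d i)) ` I d k"
      then obtain i k' where i: "p = nat (z - \<delta> d i)" and k': "k' \<in> S" "int k' = z - \<delta> d i"
        by (auto simp: I_def z_def)
      have "p = k'"
        unfolding i by (simp only: k'(2)[symmetric] nat_int)
      then have "p \<in> S" "int p = z - \<delta> d i"
        using k' by simp_all
      moreover have "p \<in> {nat (z - int r)..<nat (z - int r) + 2 * r}"
        using \<open>int p = z - \<delta> d i\<close> \<delta>_bound[of d i] by auto
      ultimately show "p \<in> S \<inter> {nat (z - int r)..<nat (z - int r) + 2 * r}"
        by blast
    qed
    then have "card (I d k) \<le> card (S \<inter> {nat (z - int r)..<nat (z - int r) + 2 * r})"
      using inj by (intro card_inj_on_le) auto
    then show ?thesis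
      using window order_trans by blast
  qed
  have sub: "cross_returns L s r S m \<subseteq>
    (\<Union>(d, k)\<in>(D - {0}) \<times> S. (\<lambda>i. column_start L s i + k) ` I d k)"
  proof
    fix p assume "p \<in> cross_returns L s r S m"
    then obtain i i' k k' where *: "1 \<le> i" "i < i'" "i' \<le> r" "k \<in> S" "k' \<in> S"
      "p = column_start L s i + k" "p + m = column_start L s i' + k'"
      by (auto simp: cross_returns_def)
    define d where "d = i' - i"
    have d: "i' = i + d" "0 < d"
      using *(2) by (auto simp: d_def)
    have k': "int k' = int k + int m - int d * M - \<delta> d i"
      using column_start_telescope[OF s, where i = i and d = d and L = L] * d
      by (simp add: M_def \<delta>_def)
    have "int k < int L" "int k' < int L"
      using *(4,5) S by auto
    then have "\<bar>int m - int d * M\<bar> < M"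
      using k' \<delta>_bound[of d i] H unfolding M_def by linarith
    then have dlow: "int d * M < int m + M" and dhigh: "int m < (int d + 1) * M"
      by (auto simp: algebra_simps)
    have "int m div M < int d + 1"
    proof (rule ccontr)
      assume "\<not> int m div M < int d + 1"
      then have "(int d + 1) * M \<le> int m div M * M"
        using M0 by (intro mult_right_mono) auto
      also have "\<dots> \<le> int m"
        using M0 pos_mod_sign[of M "int m"] div_mult_mod_eq[of "int m" M] by linarith
      finally show False
        using dhigh by simp
    qed
    moreover have "int d - 1 \<le> int m div M"
    proof -
      have "(int d - 1) * M \<le> int m"
        using dlow by (simp add: algebra_simps)
      then show ?thesis
        using zdiv_mono1[of "(int d - 1) * M" "int m" M] M0 by simp
    qed
    ultimately have "d \<in> D"
      unfolding D_def by auto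
    moreover have "i \<in> I d k"
      using * d k' by (auto simp: I_def)
    ultimately show "p \<in> (\<Union>(d, k)\<in>(D - {0}) \<times> S. (\<lambda>i. column_start L s i + k) ` I d k)"
      using *(4,6) d(2) by auto
  qed
  have finI: "finite (I d k)" for d k
    by (simp add: I_def)
  have finD: "finite D"
    by (simp add: D_def)
  have "card (cross_returns L s r S m) \<le>
    card (\<Union>(d, k)\<in>(D - {0}) \<times> S. (\<lambda>i. column_start L s i + k) ` I d k)"
    using finI finD finS by (intro card_mono sub) auto
  also have "\<dots> \<le> (\<Sum>x\<in>(D - {0}) \<times> S. card (case x of (d, k) \<Rightarrow> (\<lambda>i. column_start L s i + k) ` I d k))"
    using finD finS by (intro card_UN_le) auto
  also have "\<dots> \<le> (\<Sum>x\<in>(D - {0}) \<times> S. c)"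
    using card_I finI by (intro sum_mono) (auto intro: order_trans[OF card_image_le])
  also have "\<dots> = card (D - {0}) * card S * c"
    by (simp add: card_cartesian_product)
  also have "\<dots> \<le> 2 * card S * c"
  proof -
    have "card (D - {0}) \<le> card D"
      by (rule card_mono) (auto simp: finD)
    also have "\<dots> \<le> 2"
      by (simp add: D_def)
    finally show ?thesis
      by simp
  qed
  finally show ?thesis .
qed

definition returns :: "nat set \<Rightarrow> nat \<Rightarrow> nat set" where
  "returns S m = {p \<in> S. p + m \<in> S}"

text \<open>Columns are traversed in increasing order, so a return either stays in its column, where it
  is a return of \<open>S\<close> itself, or is a crossing return.\<close>

lemma card_returns_stack_le:
  assumes "S \<subseteq> {..<L}"
  shows "card (returns (stack L s r S) m)
    \<le> r * card (returns S m) + card (cross_returns L s r S m)"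
proof -
  have fin: "finite S"
    using assms finite_subset by blast
  have "returns (stack L s r S) m \<subseteq> stack L s r (returns S m) \<union> cross_returns L s r S m"
  proof
    fix p assume p: "p \<in> returns (stack L s r S) m"
    then obtain i k where i: "1 \<le> i" "i \<le> r" "k \<in> S" "p = column_start L s i + k"
      by (auto simp: returns_def elim: stackE)
    from p obtain i' k' where i': "1 \<le> i'" "i' \<le> r" "k' \<in> S" "p + m = column_start L s i' + k'"
      by (auto simp: returns_def elim: stackE)
    have "i \<le> i'"
      using column_index_le[of i' k' L s i k] i i' assms by fastforce
    show "p \<in> stack L s r (returns S m) \<union> cross_returns L s r S m"
    proof (cases "i = i'")
      case True
      then have "k + m = k'"
        using i i' by simp
      then have "k \<in> returns S m"
        using i(3) i'(3) by (simp add: returns_def)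
      then show ?thesis
        using i by (auto simp: stack_def)
    next
      case False
      then show ?thesis
        using i i' \<open>i \<le> i'\<close> unfolding cross_returns_def
        by (intro UnI2 CollectI exI[of _ i] exI[of _ i'] exI[of _ k] exI[of _ k']) simp
    qed
  qed
  moreover have "finite (cross_returns L s r S m)"
    by (rule finite_subset[OF _ finite_stack[OF fin, of L s r]]) (fastforce simp: cross_returns_def stack_def)
  ultimately have "card (returns (stack L s r S) m)
      \<le> card (stack L s r (returns S m) \<union> cross_returns L s r S m)"
    using fin by (intro card_mono) (auto intro: finite_stack simp: returns_def)
  also have "\<dots> \<le> card (stack L s r (returns S m)) + card (cross_returns L s r S m)"
    by (rule card_Un_le)
  also have "card (stack L s r (returns S m)) \<le> r * card (returns S m)"
    by (rule card_stack_le) (use fin in \<open>simp add: returns_def\<close>)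
  finally show ?thesis by simp
qed

lemma returns_empty: "S \<subseteq> {..<L} \<Longrightarrow> L \<le> m \<Longrightarrow> returns S m = {}"
  by (auto simp: returns_def)

text \<open>Leaving the stack within a time \<open>m\<close> that is at most the height of one column is possible only
  from the last column.\<close>

lemma card_top_stack_le:
  assumes "S \<subseteq> {..<L}" "m \<le> L"
  shows "card {p \<in> stack L s r S. column_start L s (r + 1) \<le> p + m} \<le> card S"
proof -
  have "{p \<in> stack L s r S. column_start L s (r + 1) \<le> p + m} \<subseteq> (+) (column_start L s r) ` S"
  proof clarify
    fix p assume p: "p \<in> stack L s r S" "column_start L s (r + 1) \<le> p + m"
    then obtain i k where i: "1 \<le> i" "i \<le> r" "k \<in> S" "p = column_start L s i + k"
      by (auto elim: stackE)
    have "i = r"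
    proof (rule ccontr)
      assume "i \<noteq> r"
      then have "column_start L s i + L \<le> column_start L s r"
        using column_start_less[of i r L s] i by simp
      moreover have "column_start L s r + L \<le> column_start L s (r + 1)"
        using column_start_less[of r "r + 1" L s] i by simp
      moreover have "k < L"
        using i assms by auto
      ultimately show False
        using p(2) i(4) assms(2) by linarith
    qed
    then show "p \<in> (+) (column_start L s r) ` S"
      using i by auto
  qed
  moreover have "finite S"
    using assms finite_subset by blast
  ultimately show ?thesis
    by (meson card_image_le card_mono finite_imageI order_trans)
qed

section \<open>Separated sets in windows\<close>

definition separated :: "nat \<Rightarrow> nat set \<Rightarrow> bool" where
  "separated L B \<longleftrightarrow> (\<forall>b\<in>B. \<forall>b'\<in>B. b < b' \<longrightarrow> b + L \<le> b')"

lemma card_separated_le: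
  assumes "separated L B" "0 < L"
  shows "card (B \<inter> {x..<x + y}) \<le> y div L + 2"
proof -
  have "inj_on (\<lambda>b. b div L) (B \<inter> {x..<x + y})"
  proof (rule linorder_inj_onI')
    fix b b' assume b: "b \<in> B \<inter> {x..<x + y}" "b' \<in> B \<inter> {x..<x + y}" "b < b'"
    then have "b + L \<le> b'"
      using assms(1) by (auto simp: separated_def)
    then have "(b + L) div L \<le> b' div L"
      by (rule div_le_mono)
    then show "b div L \<noteq> b' div L"
      using assms(2) by simp
  qed
  moreover have "(\<lambda>b. b div L) ` (B \<inter> {x..<x + y}) \<subseteq> {x div L..x div L + y div L + 1}"
  proof (clarsimp simp: div_le_mono)
    fix b assume "b < x + y"
    then have "b div L \<le> (x + y) div L"
      by (simp add: div_le_mono)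
    also have "\<dots> \<le> x div L + y div L + 1"
    proof -
      have "x mod L + y mod L < 2 * L"
        using add_strict_mono[of "x mod L" L "y mod L" L] assms(2) by simp
      then have "(x mod L + y mod L) div L < 2"
        by (rule less_mult_imp_div_less)
      then show ?thesis
        by (simp add: div_add1_eq[of x y])
    qed
    finally show "b div L \<le> Suc (x div L + y div L)"
      by simp
  qed
  ultimately have "card (B \<inter> {x..<x + y}) \<le> card {x div L..x div L + y div L + 1}"
    by (intro card_inj_on_le) auto
  then show ?thesis
    by simp
qed

text \<open>The copies meeting the window start in its extension by \<open>L\<close> to the left, which adds at most one
  to the number of separated starting points.\<close>

lemma card_window_separated_copies_le:
  assumes "separated L B" "0 < L" "S \<subseteq> {..<L}"
  shows "card ((\<Union>b\<in>B. (+) b ` S) \<inter> {u..<u + y}) \<le> (y div L + 3) * card S"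
proof -
  define B' where "B' = B \<inter> {u - L..<u - L + (y + L)}"
  have fin: "finite S"
    using assms finite_subset by blast
  have "(\<Union>b\<in>B. (+) b ` S) \<inter> {u..<u + y} \<subseteq> (\<Union>b\<in>B'. (+) b ` S)"
    using assms(3) by (fastforce simp: B'_def)
  then have "card ((\<Union>b\<in>B. (+) b ` S) \<inter> {u..<u + y}) \<le> card (\<Union>b\<in>B'. (+) b ` S)"
    using fin by (intro card_mono) (auto simp: B'_def)
  also have "\<dots> \<le> (\<Sum>b\<in>B'. card ((+) b ` S))"
    by (intro card_UN_le) (simp add: B'_def)
  also have "\<dots> \<le> card B' * card S"
    by (intro sum_bounded_above[THEN order_trans]) (auto intro: card_image_le fin)
  also have "card B' \<le> y div L + 3"
    using card_separated_le[OF assms(1,2), of "u - L" "y + L"] assms(2) by (simp add: B'_def)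
  finally show ?thesis
    by simp
qed

lemma separated_stack:
  assumes "separated K B" "\<And>b. b \<in> B \<Longrightarrow> b + K \<le> L"
  shows "separated K (stack L s r B)"
  unfolding separated_def
proof (intro ballI impI)
  fix p p' assume p: "p \<in> stack L s r B" and p': "p' \<in> stack L s r B" and "p < p'"
  from p obtain i k where i: "1 \<le> i" "i \<le> r" "k \<in> B" "p = column_start L s i + k"
    by (rule stackE)
  from p' obtain i' k' where i': "1 \<le> i'" "i' \<le> r" "k' \<in> B" "p' = column_start L s i' + k'"
    by (rule stackE)
  consider "i < i'" | "i = i'" | "i' < i"
    by linarith
  then show "p + K \<le> p'"
  proof cases
    case 1
    then show ?thesis
      using column_start_less[of i i' L s] i i' assms(2)[of k] by linarith
  next
    case 2
    then show ?thesis
      using assms(1) i i' \<open>p < p'\<close> by (auto simp: separated_def)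
  next
    case 3
    then show ?thesis
      using column_start_less[of i' i L s] i i' assms(2)[of k'] \<open>p < p'\<close> by linarith
  qed
qed

section \<open>The towers of a rank one construction\<close>

lemma lebesgue_image_translation:
  fixes S :: "real set"
  assumes "S \<in> sets lebesgue"
  shows "(\<lambda>x. x + c) ` S \<in> sets lebesgue"
    and "emeasure lebesgue ((\<lambda>x. x + c) ` S) = emeasure lebesgue S"
proof -
  have *: "(\<lambda>x. x + c) = (+) c"
    by (auto simp: add.commute)
  show "(\<lambda>x. x + c) ` S \<in> sets lebesgue"
    unfolding * by (rule lebesgue_sets_translation[OF assms])
  show "emeasure lebesgue ((\<lambda>x. x + c) ` S) = emeasure lebesgue S"
    using emeasure_lebesgue_affine[of 1 c S] by (simp add: add.commute)
qed

lemma emeasure_incseq_le: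
  assumes "range F \<subseteq> sets lebesgue" "incseq F" "\<And>j::nat. emeasure lebesgue (F j) \<le> C"
  shows "(\<Union>j. F j) \<in> sets lebesgue" "emeasure lebesgue (\<Union>j. F j) \<le> C"
proof -
  show "(\<Union>j. F j) \<in> sets lebesgue"
    using assms(1) by blast
  have "emeasure lebesgue (\<Union>j. F j) = (SUP j. emeasure lebesgue (F j))"
    using SUP_emeasure_incseq[OF assms(1,2)] by simp
  also have "\<dots> \<le> C"
    using assms(3) by (rule SUP_least)
  finally show "emeasure lebesgue (\<Union>j. F j) \<le> C" .
qed

context rank_one_construction
begin

abbreviation levels :: "nat \<Rightarrow> nat" where
  "levels j \<equiv> height h1 r s j + 1"

abbreviation lev :: "nat \<Rightarrow> nat \<Rightarrow> real set" where
  "lev \<equiv> level w a"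

definition tower :: "nat \<Rightarrow> real set" where
  "tower j = (\<Union>k\<in>{..<levels j}. lev j k)"

definition points :: "real set" where
  "points = (\<Union>j. tower j)"

lemma column_base_eq: "column_base h1 r s j = column_start (levels j) (s j)"
  by (simp add: column_base_def column_start_def fun_eq_iff)

lemma levels_Suc: "levels (Suc j) = column_start (levels j) (s j) (r j + 1)"
proof -
  have "column_start (levels j) (s j) (r j + 1) = (\<Sum>l=1..r j. levels j + s j l)"
    by (simp add: column_start_def atLeastLessThanSuc_atLeastAtMost)
  also have "\<dots> = levels j * r j + (\<Sum>l=1..r j. s j l)"
    by (subst sum.distrib) simp
  finally show ?thesis
    using cuts_pos[of j] by (simp add: Suc_diff_Suc)
qed

lemma width_pos': "w j > 0"
  by (induction j) (simp_all add: width_pos width_Suc cuts_pos)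

lemma level_split:
  assumes "k < levels j"
  shows "lev j k = (\<Union>i\<in>{1..r j}. lev (Suc j) (column_start (levels j) (s j) i + k))"
    (is "_ = ?R")
proof -
  define v where "v = w (Suc j)"
  have v: "v > 0" "w j = real (r j) * v"
    using width_pos'[of "Suc j"] cuts_pos[of j] by (auto simp: v_def width_Suc)
  have lev_Suc: "lev (Suc j) (column_start (levels j) (s j) i + k)
      = {a j k + real (i - 1) * v..<a j k + real (i - 1) * v + v}" if "i \<in> {1..r j}" for i
    using cut[of i j k] that assms by (simp add: level_def column_base_eq v_def)
  show ?thesis
  proof (intro equalityI subsetI)
    fix x assume x: "x \<in> lev j k"
    define z where "z = (x - a j k) / v"
    have z: "0 \<le> z" "z < real (r j)"
      using x v by (auto simp: z_def level_def field_simps)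
    define i where "i = nat \<lfloor>z\<rfloor> + 1"
    have i: "i \<in> {1..r j}"
      using z unfolding i_def by (simp add: Suc_le_eq nat_less_iff floor_less_iff)
    have "real (i - 1) \<le> z" "z < real (i - 1) + 1"
      using z(1) unfolding i_def by simp_all
    then have "real (i - 1) * v \<le> x - a j k" "x - a j k < (real (i - 1) + 1) * v"
      using v(1) by (simp_all add: z_def field_simps)
    then have "x \<in> lev (Suc j) (column_start (levels j) (s j) i + k)"
      unfolding lev_Suc[OF i] by (simp add: algebra_simps)
    then show "x \<in> ?R"
      using i by blast
  next
    fix x assume "x \<in> ?R"
    then obtain i where i: "i \<in> {1..r j}" "x \<in> lev (Suc j) (column_start (levels j) (s j) i + k)"
      by blast
    then have x: "a j k + real (i - 1) * v \<le> x" "x < a j k + real (i - 1) * v + v"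
      using lev_Suc by auto
    have "0 \<le> real (i - 1) * v"
      using v by simp
    moreover have "(real (i - 1) + 1) * v \<le> real (r j) * v"
      using i v by (intro mult_right_mono) auto
    ultimately show "x \<in> lev j k"
      using x v(2) unfolding level_def atLeastLessThan_iff distrib_right by linarith
  qed
qed

lemma levels_split:
  assumes "S \<subseteq> {..<levels j}"
  shows "(\<Union>k\<in>S. lev j k) = (\<Union>p\<in>stack (levels j) (s j) (r j) S. lev (Suc j) p)"
proof -
  have "(\<Union>k\<in>S. lev j k)
      = (\<Union>k\<in>S. \<Union>i\<in>{1..r j}. lev (Suc j) (column_start (levels j) (s j) i + k))"
    by (rule SUP_cong[OF refl level_split]) (use assms in auto)
  also have "\<dots> = (\<Union>p\<in>stack (levels j) (s j) (r j) S. lev (Suc j) p)"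
    by (fastforce simp: stack_def)
  finally show ?thesis .
qed

lemma level_disjoint:
  assumes "x \<in> lev j k" "x \<in> lev j l" "k < levels j" "l < levels j"
  shows "k = l"
  using disjoint_levels[of j] assms unfolding disjoint_family_on_def by fastforce

text \<open>A union of levels of stage \<open>n\<close> is a union of levels of each later stage \<open>n + t\<close>; the recursion
  computes their indices.\<close>

primrec spread :: "nat \<Rightarrow> nat set \<Rightarrow> nat \<Rightarrow> nat set" where
  "spread n S 0 = S"
| "spread n S (Suc t) = stack (levels (n + t)) (s (n + t)) (r (n + t)) (spread n S t)"

lemma spread_bound: "S \<subseteq> {..<levels n} \<Longrightarrow> spread n S t \<subseteq> {..<levels (n + t)}"
proof (induction t)
  case (Suc t)
  then show ?case
    using stack_bound[of "spread n S t" "levels (n + t)"] levels_Suc[of "n + t"] by simp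
qed simp

lemma finite_spread: "finite S \<Longrightarrow> finite (spread n S t)"
  by (induction t) (simp_all add: finite_stack)

lemma spread_add: "spread n S (t + t') = spread (n + t) (spread n S t) t'"
  by (induction t') (simp_all add: add.assoc)

lemma spread_copies: "spread n S t = (\<Union>b\<in>spread n {0} t. (+) b ` S)"
proof (induction t)
  case (Suc t)
  show ?case
    by (simp only: spread.simps(2)) (subst Suc, rule stack_UN)
qed simp

lemma separated_spread: "separated (levels n) (spread n {0} t)"
proof (induction t)
  case (Suc t)
  have "b + levels n \<le> levels (n + t)" if "b \<in> spread n {0} t" for b
  proof -
    have "b + height h1 r s n \<in> spread n {..<levels n} t"
      using that spread_copies[of n "{..<levels n}" t] by auto
    then show ?thesis
      using spread_bound[of "{..<levels n}" n t] by auto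
  qed
  then show ?case
    using separated_stack[OF Suc] by simp
qed (simp add: separated_def)

lemma width_card_spread_le:
  assumes "finite S"
  shows "w (n + t) * real (card (spread n S t)) \<le> w n * real (card S)"
proof (induction t)
  case (Suc t)
  have "w (n + Suc t) * real (card (spread n S (Suc t)))
      \<le> w (n + Suc t) * real (r (n + t) * card (spread n S t))"
    using width_pos'[of "n + Suc t"] card_stack_le[OF finite_spread[OF assms]]
    by (intro mult_left_mono of_nat_mono) (auto simp del: of_nat_mult)
  also have "\<dots> = w (n + t) * real (card (spread n S t))"
    using cuts_pos[of "n + t"] by (simp add: width_Suc)
  finally show ?case
    using Suc by linarith
qed simp

lemma spread_levels: "S \<subseteq> {..<levels n} \<Longrightarrow> (\<Union>k\<in>S. lev n k) = (\<Union>p\<in>spread n S t. lev (n + t) p)"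
proof (induction t)
  case (Suc t)
  then show ?case
    using levels_split[OF spread_bound[OF Suc.prems, of t]] by simp
qed simp

text \<open>The levels reached at a late stage form copies of those reached at the intermediate stage
  \<open>n + t1\<close>, and the copies are separated by at least the number of levels of that stage.\<close>

lemma card_spread_window_le:
  assumes "t1 \<le> t" "S \<subseteq> {..<levels n}"
  shows "card (spread n S t \<inter> {u..<u + y}) \<le> (y div levels (n + t1) + 3) * card (spread n S t1)"
proof -
  obtain t2 where t: "t = t1 + t2"
    using assms(1) le_Suc_ex by blast
  show ?thesis
    unfolding t spread_add spread_copies[of "n + t1" "spread n S t1" t2]
    by (rule card_window_separated_copies_le[OF separated_spread _ spread_bound[OF assms(2)]]) simp
qed

lemma tower_eq: "tower n = (\<Union>p\<in>spread n {..<levels n} t. lev (n + t) p)"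
  unfolding tower_def by (rule spread_levels) simp

lemma tower_mono: "tower n \<subseteq> tower (n + t)"
proof -
  have "spread n {..<levels n} t \<subseteq> {..<levels (n + t)}"
    by (rule spread_bound) simp
  then show ?thesis
    unfolding tower_eq[of n t] tower_def[of "n + t"] by blast
qed

lemma incseq_tower: "incseq tower"
  using tower_mono[of _ 1] by (intro incseq_SucI) simp

lemma level_measurable [measurable]: "lev j k \<in> sets lebesgue"
  by (simp add: level_def)

lemma emeasure_level: "emeasure lebesgue (lev j k) = ennreal (w j)"
  using width_pos'[of j] by (simp add: level_def)

lemma emeasure_levels_le:
  assumes "finite S"
  shows "emeasure lebesgue (\<Union>k\<in>S. lev j k) \<le> ennreal (w j * real (card S))"
proof -
  have "emeasure lebesgue (\<Union>k\<in>S. lev j k) \<le> (\<Sum>k\<in>S. emeasure lebesgue (lev j k))"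
    using assms by (intro emeasure_subadditive_finite) auto
  also have "\<dots> = ennreal (w j * real (card S))"
    using width_pos'[of j] by (simp add: emeasure_level ennreal_mult ennreal_of_nat_eq_real_of_nat mult.commute)
  finally show ?thesis .
qed

lemma tower_measurable [measurable]: "tower j \<in> sets lebesgue"
  unfolding tower_def by (intro sets.finite_UN) auto

lemma points_measurable [measurable]: "points \<in> sets lebesgue"
  unfolding points_def by (intro sets.countable_UN) auto

lemma rank_one_space_eq: "rank_one_space h1 r s w a = restrict_space lebesgue points"
  unfolding rank_one_space_def points_def tower_def
  by (simp add: lessThan_Suc_atMost atLeast0AtMost)

lemma sets_rank_one_space:
  "E \<in> sets (rank_one_space h1 r s w a) \<longleftrightarrow> E \<in> sets lebesgue \<and> E \<subseteq> points"
  unfolding rank_one_space_eq by (subst sets_restrict_space_iff) auto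

lemma space_rank_one_space: "space (rank_one_space h1 r s w a) = points"
  by (simp add: rank_one_space_eq space_restrict_space)

lemma emeasure_rank_one_space:
  "E \<subseteq> points \<Longrightarrow> emeasure (rank_one_space h1 r s w a) E = emeasure lebesgue E"
  unfolding rank_one_space_eq by (subst emeasure_restrict_space) auto

section \<open>Reduction of mixing to returns of towers\<close>

definition nontop :: "nat \<Rightarrow> real set" where
  "nontop j = (\<Union>k\<in>{..<height h1 r s j}. lev j k)"

lemma T_eq: "k < height h1 r s j \<Longrightarrow> x \<in> lev j k \<Longrightarrow> T x = x + (a j (Suc k) - a j k)"
  by (rule translate)

lemma T_level: "k < height h1 r s j \<Longrightarrow> x \<in> lev j k \<Longrightarrow> T x \<in> lev j (Suc k)"
  by (simp add: T_eq level_def)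

lemma T_power_level:
  "k + m \<le> height h1 r s j \<Longrightarrow> x \<in> lev j k \<Longrightarrow> (T ^^ m) x \<in> lev j (k + m)"
proof (induction m)
  case (Suc m)
  then show ?case
    using T_level[of "k + m" j "(T ^^ m) x"] by simp
qed simp

lemma nontop_Suc: "nontop j \<subseteq> nontop (Suc j)"
proof
  fix x assume "x \<in> nontop j"
  then obtain k where k: "k < height h1 r s j" "x \<in> lev j k"
    by (auto simp: nontop_def)
  then obtain i where i: "i \<in> {1..r j}" "x \<in> lev (Suc j) (column_start (levels j) (s j) i + k)"
    using level_split[of k j] by auto
  have "column_start (levels j) (s j) i + k < height h1 r s (Suc j)"
    using column_start_less[of i "r j + 1" "levels j" "s j"] i(1) k(1) levels_Suc[of j] by simp
  then show "x \<in> nontop (Suc j)"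
    using i(2) unfolding nontop_def by blast
qed

lemma incseq_nontop: "incseq nontop"
  by (intro incseq_SucI nontop_Suc)

lemma nontop_subset: "nontop j \<subseteq> points"
  unfolding nontop_def points_def tower_def by fastforce

text \<open>A point that never leaves the top levels would have to lie in the last column of every late
  stage. These columns end at a common right end point, which the half-open intervals omit, while
  their widths tend to \<open>0\<close>.\<close>

lemma points_eq_UN_nontop:
  assumes width: "w \<longlonglongrightarrow> 0"
  shows "points = (\<Union>j. nontop j)"
proof
  show "(\<Union>j. nontop j) \<subseteq> points"
    using nontop_subset by blast
  show "points \<subseteq> (\<Union>j. nontop j)"
  proof
    fix x assume "x \<in> points"
    then obtain n where n: "x \<in> tower n"
      by (auto simp: points_def)
    show "x \<in> (\<Union>j. nontop j)"
    proof (rule ccontr)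
      assume never: "x \<notin> (\<Union>j. nontop j)"
      have top: "x \<in> lev (n + t) (height h1 r s (n + t))" for t
      proof -
        have "x \<in> tower (n + t)"
          using n tower_mono by blast
        then show ?thesis
          using never by (auto simp: tower_def nontop_def less_Suc_eq)
      qed
      define e where "e = a n (height h1 r s n) + w n"
      have right_end: "a (n + t) (height h1 r s (n + t)) + w (n + t) = e" for t
      proof (induction t)
        case (Suc t)
        define j where "j = n + t"
        define h where "h = height h1 r s j"
        have "x \<in> lev j h"
          using top[of t] by (simp add: j_def h_def)
        then obtain i where i: "i \<in> {1..r j}" "x \<in> lev (Suc j) (column_start (levels j) (s j) i + h)"
          using level_split[of h j] by (auto simp: h_def)
        have "column_start (levels j) (s j) i + h < levels (Suc j)"
          using column_start_less[of i "r j + 1" "levels j" "s j"] i(1) levels_Suc[of j]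
          by (simp add: h_def)
        then have eq: "height h1 r s (Suc j) = column_start (levels j) (s j) i + h"
          using level_disjoint[of x "Suc j"] i(2) top[of "Suc t"] by (simp add: j_def)
        have "i = r j"
        proof (rule ccontr)
          assume "i \<noteq> r j"
          then have "column_start (levels j) (s j) i + levels j \<le> column_start (levels j) (s j) (r j)"
            "column_start (levels j) (s j) (r j) + levels j \<le> levels (Suc j)"
            using column_start_less[of i "r j" "levels j" "s j"]
              column_start_less[of "r j" "r j + 1" "levels j" "s j"] i(1) levels_Suc[of j] by auto
          then show False
            using eq by (simp add: h_def)
        qed
        then have "a (Suc j) (height h1 r s (Suc j)) = a j h + real (r j - 1) * w (Suc j)"
          using cut[of "r j" j h] i(1) eq by (simp add: h_def column_base_eq)
        moreover have "real (r j - 1) * w (Suc j) + w (Suc j) = w j"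
        proof -
          have "real (r j - 1) + 1 = real (r j)"
            using cuts_pos[of j] by linarith
          then have "real (r j - 1) * w (Suc j) + w (Suc j) = real (r j) * w (Suc j)"
            by (metis distrib_right mult_1)
          then show ?thesis
            using cuts_pos[of j] by (simp add: width_Suc)
        qed
        ultimately show ?case
          using Suc by (simp add: j_def h_def)
      qed (simp add: e_def)
      have "x < e"
        using top[of 0] by (simp add: level_def e_def)
      then obtain N where N: "\<And>j. j \<ge> N \<Longrightarrow> w j < e - x"
        using order_tendstoD(2)[OF width, of "e - x"] by (auto simp: eventually_sequentially)
      have "e - w (n + N) \<le> x"
        using top[of N] right_end[of N] by (simp add: level_def)
      then show False
        using N[of "n + N"] by simp
    qed
  qed
qed

lemma T_image_level:
  assumes "k < height h1 r s j" "E \<in> sets lebesgue"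
  shows "T ` (E \<inter> lev j k) \<in> sets lebesgue"
    and "emeasure lebesgue (T ` (E \<inter> lev j k)) = emeasure lebesgue (E \<inter> lev j k)"
proof -
  have *: "T ` (E \<inter> lev j k) = (\<lambda>x. x + (a j (Suc k) - a j k)) ` (E \<inter> lev j k)"
    using T_eq[OF assms(1)] by (intro image_cong) auto
  have "E \<inter> lev j k \<in> sets lebesgue"
    using assms(2) by auto
  then show "T ` (E \<inter> lev j k) \<in> sets lebesgue"
    and "emeasure lebesgue (T ` (E \<inter> lev j k)) = emeasure lebesgue (E \<inter> lev j k)"
    unfolding * by (simp_all only: lebesgue_image_translation)
qed

lemma T_vimage_level:
  assumes "k < height h1 r s j" "E \<in> sets lebesgue"
  shows "T -` E \<inter> lev j k \<in> sets lebesgue"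
    and "emeasure lebesgue (T -` E \<inter> lev j k) = emeasure lebesgue (E \<inter> lev j (Suc k))"
proof -
  define c where "c = a j (Suc k) - a j k"
  have *: "T -` E \<inter> lev j k = (\<lambda>x. x + - c) ` (E \<inter> lev j (Suc k))"
  proof (intro equalityI subsetI)
    fix x assume x: "x \<in> T -` E \<inter> lev j k"
    then have "T x = x + c" "T x \<in> lev j (Suc k)" "T x \<in> E"
      using T_eq[OF assms(1)] T_level[OF assms(1)] by (auto simp: c_def)
    then show "x \<in> (\<lambda>x. x + - c) ` (E \<inter> lev j (Suc k))"
      by (intro image_eqI[of _ _ "T x"]) auto
  next
    fix x assume "x \<in> (\<lambda>x. x + - c) ` (E \<inter> lev j (Suc k))"
    then have x: "x + c \<in> E" "x + c \<in> lev j (Suc k)"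
      by auto
    then have "x \<in> lev j k"
      by (simp add: level_def c_def)
    moreover from this have "T x = x + c"
      using T_eq[OF assms(1)] by (simp add: c_def)
    ultimately show "x \<in> T -` E \<inter> lev j k"
      using x by simp
  qed
  have "E \<inter> lev j (Suc k) \<in> sets lebesgue"
    using assms(2) by auto
  then show "T -` E \<inter> lev j k \<in> sets lebesgue"
    and "emeasure lebesgue (T -` E \<inter> lev j k) = emeasure lebesgue (E \<inter> lev j (Suc k))"
    unfolding * by (simp_all only: lebesgue_image_translation)
qed

lemma disjoint_levels_Int: "J \<subseteq> {..height h1 r s j} \<Longrightarrow> disjoint_family_on (\<lambda>k. E \<inter> lev j k) J"
  unfolding disjoint_family_on_def
proof (intro ballI impI)
  fix k l assume "J \<subseteq> {..height h1 r s j}" "k \<in> J" "l \<in> J" "k \<noteq> l"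
  then have "lev j k \<inter> lev j l = {}"
    by (intro disjoint_family_onD[OF disjoint_levels]) auto
  then show "(E \<inter> lev j k) \<inter> (E \<inter> lev j l) = {}"
    by blast
qed

lemma T_image:
  assumes width: "w \<longlonglongrightarrow> 0" and E: "E \<in> sets lebesgue" "E \<subseteq> points"
  shows "T ` E \<in> sets lebesgue" "T ` E \<subseteq> points" "emeasure lebesgue (T ` E) \<le> emeasure lebesgue E"
proof -
  define F where "F j = T ` (E \<inter> nontop j)" for j
  have E_eq: "E = (\<Union>j. E \<inter> nontop j)"
    using E(2) points_eq_UN_nontop[OF width] by blast
  have TE: "T ` E = (\<Union>j. F j)"
    unfolding F_def by (subst E_eq) blast
  have F_eq: "F j = (\<Union>k\<in>{..<height h1 r s j}. T ` (E \<inter> lev j k))" for j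
    by (auto simp: F_def nontop_def)
  have "F j \<in> sets lebesgue" for j
    unfolding F_eq by (intro sets.finite_UN finite_lessThan T_image_level(1)[OF _ E(1)]) simp
  then have F_sets: "range F \<subseteq> sets lebesgue"
    by blast
  have "incseq F"
    unfolding incseq_def F_def using monoD[OF incseq_nontop] by blast
  moreover have "emeasure lebesgue (F j) \<le> emeasure lebesgue E" for j
  proof -
    have "emeasure lebesgue (F j) \<le> (\<Sum>k<height h1 r s j. emeasure lebesgue (T ` (E \<inter> lev j k)))"
      unfolding F_eq using T_image_level(1)[OF _ E(1)] by (intro emeasure_subadditive_finite) auto
    also have "\<dots> = (\<Sum>k<height h1 r s j. emeasure lebesgue (E \<inter> lev j k))"
      using T_image_level(2)[OF _ E(1)] by (intro sum.cong) auto
    also have "\<dots> = emeasure lebesgue (\<Union>k\<in>{..<height h1 r s j}. E \<inter> lev j k)"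
      using E(1) by (intro sum_emeasure disjoint_levels_Int) auto
    also have "\<dots> \<le> emeasure lebesgue E"
      using E(1) by (intro emeasure_mono) auto
    finally show ?thesis .
  qed
  ultimately show "T ` E \<in> sets lebesgue" "emeasure lebesgue (T ` E) \<le> emeasure lebesgue E"
    unfolding TE using emeasure_incseq_le[OF F_sets] by auto
  show "T ` E \<subseteq> points"
  proof -
    have "F j \<subseteq> tower j" for j
      using T_level by (fastforce simp: F_eq tower_def)
    then show ?thesis
      unfolding TE points_def by blast
  qed
qed

text \<open>At a fixed stage the preimage of \<open>E\<close> in the levels below the top is a union of translates of
  the parts of \<open>E\<close> in the next levels, which are disjoint; the bound passes to the limit over the
  stages.\<close>

lemma T_vimage:
  assumes width: "w \<longlonglongrightarrow> 0" and E: "E \<in> sets lebesgue"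
  shows "T -` E \<inter> points \<in> sets lebesgue" "emeasure lebesgue (T -` E \<inter> points) \<le> emeasure lebesgue E"
proof -
  define F where "F j = T -` E \<inter> nontop j" for j
  have TE: "T -` E \<inter> points = (\<Union>j. F j)"
    unfolding F_def points_eq_UN_nontop[OF width] by blast
  have F_eq: "F j = (\<Union>k\<in>{..<height h1 r s j}. T -` E \<inter> lev j k)" for j
    by (auto simp: F_def nontop_def)
  have "F j \<in> sets lebesgue" for j
    unfolding F_eq by (intro sets.finite_UN finite_lessThan T_vimage_level(1)[OF _ E]) simp
  then have F_sets: "range F \<subseteq> sets lebesgue"
    by blast
  have "incseq F"
    unfolding incseq_def F_def using monoD[OF incseq_nontop] by blast
  moreover have "emeasure lebesgue (F j) \<le> emeasure lebesgue E" for j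
  proof -
    have "emeasure lebesgue (F j) \<le> (\<Sum>k<height h1 r s j. emeasure lebesgue (T -` E \<inter> lev j k))"
      unfolding F_eq using T_vimage_level(1)[OF _ E] by (intro emeasure_subadditive_finite) auto
    also have "\<dots> = (\<Sum>k<height h1 r s j. emeasure lebesgue (E \<inter> lev j (Suc k)))"
      using T_vimage_level(2)[OF _ E] by (intro sum.cong) auto
    also have "\<dots> = (\<Sum>k\<in>Suc ` {..<height h1 r s j}. emeasure lebesgue (E \<inter> lev j k))"
      by (simp add: sum.reindex)
    also have "\<dots> = emeasure lebesgue (\<Union>k\<in>Suc ` {..<height h1 r s j}. E \<inter> lev j k)"
      using E by (intro sum_emeasure disjoint_levels_Int) auto
    also have "\<dots> \<le> emeasure lebesgue E"
      using E by (intro emeasure_mono) auto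
    finally show ?thesis .
  qed
  ultimately show "T -` E \<inter> points \<in> sets lebesgue"
    "emeasure lebesgue (T -` E \<inter> points) \<le> emeasure lebesgue E"
    unfolding TE using emeasure_incseq_le[OF F_sets] by auto
qed

lemma T_power_image:
  assumes width: "w \<longlonglongrightarrow> 0" and E: "E \<in> sets lebesgue" "E \<subseteq> points"
  shows "(T ^^ m) ` E \<in> sets lebesgue" "(T ^^ m) ` E \<subseteq> points"
    "emeasure lebesgue ((T ^^ m) ` E) \<le> emeasure lebesgue E"
proof (induction m)
  case 0
  case 1 show ?case using E by simp
  case 2 show ?case using E by simp
  case 3 show ?case by simp
next
  case (Suc m)
  have *: "(T ^^ Suc m) ` E = T ` (T ^^ m) ` E"
    by (simp add: image_comp)
  note T_image = T_image[OF width Suc(1,2)]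
  case 1 show ?case unfolding * by (rule T_image(1))
  case 2 show ?case unfolding * by (rule T_image(2))
  case 3 show ?case unfolding * by (rule order_trans[OF T_image(3) Suc(3)])
qed

lemma T_power_vimage:
  assumes width: "w \<longlonglongrightarrow> 0" and E: "E \<in> sets lebesgue" "E \<subseteq> points"
  shows "(T ^^ m) -` E \<inter> points \<in> sets lebesgue"
    "emeasure lebesgue ((T ^^ m) -` E \<inter> points) \<le> emeasure lebesgue E"
proof (induction m)
  case 0
  have *: "(T ^^ 0) -` E \<inter> points = E"
    using E by auto
  case 1 show ?case unfolding * by (rule E(1))
  case 2 show ?case unfolding * by (rule order_refl)
next
  case (Suc m)
  have "T ` points \<subseteq> points"
    by (rule T_image(2)[OF width]) auto
  then have *: "(T ^^ Suc m) -` E \<inter> points = T -` ((T ^^ m) -` E \<inter> points) \<inter> points"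
    by (auto simp: funpow_Suc_right simp del: funpow.simps)
  note T_vimage = T_vimage[OF width Suc(1)]
  case 1 show ?case unfolding * by (rule T_vimage(1))
  case 2 show ?case unfolding * by (rule order_trans[OF T_vimage(2) Suc(2)])
qed

text \<open>Cutting off the parts of \<open>A\<close> and \<open>B\<close> outside a large tower costs arbitrarily little measure,
  so only the returns of whole towers to themselves matter.\<close>

lemma mixing_if_towers_return_little:
  assumes width: "w \<longlonglongrightarrow> 0"
    and returns: "\<And>n \<epsilon>. \<epsilon> > (0::real) \<Longrightarrow>
      \<exists>N. \<forall>m>N. emeasure lebesgue (tower n \<inter> (T ^^ m) -` tower n) < ennreal \<epsilon>"
  shows "infinite_measure_mixing (rank_one_space h1 r s w a) T"
  unfolding infinite_measure_mixing_def
proof (intro allI impI ballI)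
  fix \<epsilon> :: real and A B
  assume \<epsilon>: "\<epsilon> > 0"
    and "A \<in> sets (rank_one_space h1 r s w a)" "B \<in> sets (rank_one_space h1 r s w a)"
    and "emeasure (rank_one_space h1 r s w a) A < \<infinity>" "emeasure (rank_one_space h1 r s w a) B < \<infinity>"
  then have A: "A \<in> sets lebesgue" "A \<subseteq> points" "emeasure lebesgue A < \<infinity>"
    and B: "B \<in> sets lebesgue" "B \<subseteq> points" "emeasure lebesgue B < \<infinity>"
    by (auto simp: sets_rank_one_space emeasure_rank_one_space)
  have cut_off: "\<exists>n. \<forall>n'\<ge>n. emeasure lebesgue (E - tower n') < ennreal (\<epsilon> / 3)"
    if E: "E \<in> sets lebesgue" "E \<subseteq> points" "emeasure lebesgue E < \<infinity>" for E
  proof -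
    have "(\<lambda>n. emeasure lebesgue (E - tower n)) \<longlonglongrightarrow> emeasure lebesgue (\<Inter>n. E - tower n)"
    proof (rule Lim_emeasure_decseq)
      show "range (\<lambda>n. E - tower n) \<subseteq> sets lebesgue"
        using E by auto
      show "decseq (\<lambda>n. E - tower n)"
        using incseq_tower by (auto simp: incseq_def decseq_def)
      have "emeasure lebesgue (E - tower n) \<le> emeasure lebesgue E" for n
        using E by (intro emeasure_mono) auto
      then show "emeasure lebesgue (E - tower n) \<noteq> \<infinity>" for n
        using E(3) by (metis infinity_ennreal_def leD)
    qed
    moreover have "(\<Inter>n. E - tower n) = {}"
      using E(2) by (auto simp: points_def)
    ultimately have "(\<lambda>n. emeasure lebesgue (E - tower n)) \<longlonglongrightarrow> 0"
      by (simp only: emeasure_empty)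
    then show ?thesis
      using order_tendstoD(2)[of _ 0 sequentially "ennreal (\<epsilon> / 3)"] \<epsilon>
      by (simp add: eventually_sequentially)
  qed
  obtain n1 n2 where "\<forall>n'\<ge>n1. emeasure lebesgue (A - tower n') < ennreal (\<epsilon> / 3)"
    "\<forall>n'\<ge>n2. emeasure lebesgue (B - tower n') < ennreal (\<epsilon> / 3)"
    using cut_off[OF A] cut_off[OF B] by blast
  then obtain n where n: "emeasure lebesgue (A - tower n) < ennreal (\<epsilon> / 3)"
    "emeasure lebesgue (B - tower n) < ennreal (\<epsilon> / 3)"
    using max.cobounded1[of n1 n2] max.cobounded2[of n2 n1] by blast
  obtain N where N: "\<And>m. m > N \<Longrightarrow>
      emeasure lebesgue (tower n \<inter> (T ^^ m) -` tower n) < ennreal (\<epsilon> / 3)"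
    using returns[of "\<epsilon> / 3" n] \<epsilon> by auto
  have sub: "tower n \<subseteq> points"
    by (auto simp: points_def)
  have Diff_tower: "A - tower n \<in> sets lebesgue" "A - tower n \<subseteq> points"
    using A by (auto intro: sets.Diff)
  have small: "emeasure lebesgue E < ennreal \<epsilon>"
    if E: "E \<subseteq> P \<union> Q \<union> (B - tower n)" and PQ: "P \<in> sets lebesgue" "Q \<in> sets lebesgue"
      and P: "emeasure lebesgue P < ennreal (\<epsilon> / 3)"
      and Q: "emeasure lebesgue Q \<le> emeasure lebesgue (A - tower n)" for E P Q
  proof -
    have "emeasure lebesgue E \<le> emeasure lebesgue (P \<union> Q \<union> (B - tower n))"
      using PQ B by (intro emeasure_mono E) auto
    also have "\<dots> \<le> emeasure lebesgue (P \<union> Q) + emeasure lebesgue (B - tower n)"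
      using PQ B by (intro emeasure_subadditive) auto
    also have "\<dots> \<le> emeasure lebesgue P + emeasure lebesgue Q + emeasure lebesgue (B - tower n)"
      using PQ by (intro add_right_mono emeasure_subadditive)
    also have "\<dots> < ennreal (\<epsilon> / 3 + \<epsilon> / 3 + \<epsilon> / 3)"
      using P n(2) le_less_trans[OF Q n(1)] by (intro add_mono_ennreal)
    finally show ?thesis
      by simp
  qed
  show "\<exists>N::nat. \<forall>k::int. \<bar>k\<bar> > int N \<longrightarrow>
    emeasure (rank_one_space h1 r s w a) (power_set (rank_one_space h1 r s w a) T k A \<inter> B) < ennreal \<epsilon>"
  proof (intro exI[of _ N] allI impI)
    fix k :: int assume k: "\<bar>k\<bar> > int N"
    let ?P = "power_set (rank_one_space h1 r s w a) T k A \<inter> B"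
    have "emeasure lebesgue ?P < ennreal \<epsilon>"
    proof (cases "k \<ge> 0")
      case True
      define m where "m = nat k"
      have m: "m > N"
        using k True by (simp add: m_def)
      let ?C = "tower n \<inter> (T ^^ m) -` tower n"
      have C: "?C \<in> sets lebesgue"
      proof -
        have "?C = tower n \<inter> ((T ^^ m) -` tower n \<inter> points)"
          using sub by blast
        then show ?thesis
          by (simp only: sets.Int[OF tower_measurable T_power_vimage(1)[OF width tower_measurable sub]])
      qed
      have "?C \<subseteq> points"
        using sub by blast
      note C_image = T_power_image[OF width C this, of m]
      have *: "?P = (T ^^ m) ` A \<inter> B"
        using True by (simp add: power_set_def m_def)
      show ?thesis
        unfolding *
      proof (rule small[of _ "(T ^^ m) ` ?C" "(T ^^ m) ` (A - tower n)"])
        show "(T ^^ m) ` A \<inter> B \<subseteq> (T ^^ m) ` ?C \<union> (T ^^ m) ` (A - tower n) \<union> (B - tower n)"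
          by blast
        show "(T ^^ m) ` ?C \<in> sets lebesgue"
          by (rule C_image(1))
        show "emeasure lebesgue ((T ^^ m) ` ?C) < ennreal (\<epsilon> / 3)"
          by (rule le_less_trans[OF C_image(3) N[OF m]])
        show "(T ^^ m) ` (A - tower n) \<in> sets lebesgue"
          "emeasure lebesgue ((T ^^ m) ` (A - tower n)) \<le> emeasure lebesgue (A - tower n)"
          by (rule T_power_image[OF width Diff_tower])+
      qed
    next
      case False
      define m where "m = nat (- k)"
      have m: "m > N"
        using k False by (simp add: m_def)
      let ?C = "tower n \<inter> (T ^^ m) -` tower n"
      have C: "?C = tower n \<inter> ((T ^^ m) -` tower n \<inter> points)"
        using sub by blast
      have *: "?P = (T ^^ m) -` A \<inter> points \<inter> B"
        using False by (simp add: power_set_def m_def space_rank_one_space)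
      show ?thesis
        unfolding *
      proof (rule small[of _ "?C" "(T ^^ m) -` (A - tower n) \<inter> points"])
        show "(T ^^ m) -` A \<inter> points \<inter> B \<subseteq> ?C \<union> ((T ^^ m) -` (A - tower n) \<inter> points) \<union> (B - tower n)"
          by blast
        show "?C \<in> sets lebesgue"
          unfolding C
          by (intro sets.Int tower_measurable T_power_vimage(1)[OF width tower_measurable sub])
        show "emeasure lebesgue ?C < ennreal (\<epsilon> / 3)"
          by (rule N[OF m])
        show "(T ^^ m) -` (A - tower n) \<inter> points \<in> sets lebesgue"
          "emeasure lebesgue ((T ^^ m) -` (A - tower n) \<inter> points) \<le> emeasure lebesgue (A - tower n)"
          by (rule T_power_vimage[OF width Diff_tower])+
      qed
    qed
    then show "emeasure (rank_one_space h1 r s w a) ?P < ennreal \<epsilon>"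
      using B(2) by (subst emeasure_rank_one_space) auto
  qed
qed

end

section \<open>Mixing\<close>

locale residue_spacer_construction = rank_one_construction +
  fixes q H :: "nat \<Rightarrow> int"
  assumes prime_cuts: "\<And>j. prime (r j)"
    and cuts_at_top: "filterlim r at_top sequentially"
    and generator: "\<And>j. generates_residue_units (int (r j)) (q j)"
    and H_ge: "\<And>j. H j \<ge> int (r j)"
    and spacers: "\<And>j i. i \<in> {1..r j - 1} \<Longrightarrow>
      int (s j i) = H j + q j ^ i mod int (r j) - q j ^ (i + 1) mod int (r j)"
    and infinite: "emeasure (rank_one_space h1 r s w a) (space (rank_one_space h1 r s w a)) = \<infinity>"
begin

(* The recursion for the heights enters only through levels_Suc. *)
declare height.simps(2) [simp del]

lemma cuts_ge_2: "r j \<ge> 2"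
  using prime_cuts by (rule prime_ge_2_nat)

lemma width_le: "w j \<le> w 0 / 2 ^ j"
proof (induction j)
  case (Suc j)
  have "w (Suc j) \<le> w j / 2"
    unfolding width_Suc using cuts_ge_2[of j] width_pos'[of j] by (intro divide_left_mono) auto
  then show ?case
    using Suc by simp
qed simp

lemma width_tendsto_0: "w \<longlonglongrightarrow> 0"
proof (rule tendsto_sandwich)
  show "\<forall>\<^sub>F j in sequentially. 0 \<le> w j"
    using width_pos' by (simp add: less_imp_le)
  show "\<forall>\<^sub>F j in sequentially. w j \<le> w 0 / 2 ^ j"
    using width_le by simp
  show "(\<lambda>j. w 0 / 2 ^ j) \<longlonglongrightarrow> 0"
    using LIMSEQ_divide_realpow_zero[of 2 "w 0"] by simp
qed simp

lemma levels_less: "levels j < levels (Suc j)"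
proof -
  have "column_start (levels j) (s j) 1 + levels j \<le> column_start (levels j) (s j) (r j)"
    using column_start_less[of 1 "r j" "levels j" "s j"] cuts_ge_2[of j] by simp
  moreover have "column_start (levels j) (s j) (r j) + levels j \<le> levels (Suc j)"
    using column_start_less[of "r j" "r j + 1" "levels j" "s j"] cuts_ge_2[of j] levels_Suc[of j] by simp
  ultimately show ?thesis
    by simp
qed

lemma levels_ge: "j < levels j"
proof (induction j)
  case (Suc j)
  then show ?case
    using levels_less[of j] by linarith
qed simp

lemma stage_of_time:
  assumes "levels j0 \<le> m"
  obtains j where "j0 \<le> j" "levels j \<le> m" "m < levels (Suc j)"
proof -
  define j where "j = (GREATEST j. levels j \<le> m)"
  have bound: "\<And>i. levels i \<le> m \<Longrightarrow> i \<le> m"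
    using levels_ge by (meson less_imp_le less_le_trans)
  have "levels j \<le> m"
    unfolding j_def by (rule GreatestI_nat[where k = j0 and b = m]) (use assms bound in auto)
  moreover have "j0 \<le> j"
    unfolding j_def by (rule Greatest_le_nat[where b = m]) (use assms bound in auto)
  moreover have "m < levels (Suc j)"
  proof (rule ccontr)
    assume "\<not> m < levels (Suc j)"
    then have "levels (Suc j) \<le> m"
      by (simp only: not_less)
    then have "Suc j \<le> (GREATEST j. levels j \<le> m)"
      by (rule Greatest_le_nat[where b = m]) (use bound in auto)
    then have "Suc j \<le> j"
      by (simp only: j_def)
    then show False
      by simp
  qed
  ultimately show ?thesis
    using that by blast
qed

lemma tower_measure_unbounded:
  obtains t where "w (n + t) * real (levels (n + t)) > C"
proof -
  have "\<exists>t. w (n + t) * real (levels (n + t)) > C"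
  proof (rule ccontr)
    assume none: "\<not> ?thesis"
    have "emeasure lebesgue (tower j) \<le> ennreal C" for j
    proof -
      have "tower j \<subseteq> tower (n + j)"
        using incseq_tower by (simp add: incseq_def)
      then have "emeasure lebesgue (tower j) \<le> emeasure lebesgue (tower (n + j))"
        by (intro emeasure_mono) auto
      also have "\<dots> \<le> ennreal (w (n + j) * real (levels (n + j)))"
        using emeasure_levels_le[of "{..<levels (n + j)}" "n + j"] by (simp add: tower_def)
      also have "\<dots> \<le> ennreal C"
        using none by (intro ennreal_leI) (auto simp: not_less)
      finally show ?thesis .
    qed
    then have "emeasure lebesgue points \<le> ennreal C"
      unfolding points_def by (intro emeasure_incseq_le(2) incseq_tower) auto
    moreover have "emeasure lebesgue points = \<infinity>"
      using infinite by (simp add: space_rank_one_space emeasure_rank_one_space)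
    ultimately show False
      by (simp add: top_unique)
  qed
  then show ?thesis
    using that by blast
qed

text \<open>Put \<open>j = n + t\<close>. A return at time \<open>m\<close>, seen at stage \<open>j + 2\<close>, crosses columns of stage \<open>j\<close>, or crosses columns of stage \<open>j + 1\<close>, or leaves
  the tower of stage \<open>j + 2\<close>, and then starts in the last of its \<open>r (j + 1)\<close> columns.\<close>

lemma emeasure_tower_returns_le:
  assumes S: "\<And>t. S t = spread n {..<levels n} t"
    and window: "\<And>u. card (S t \<inter> {u..<u + 2 * r (n + t)}) \<le> c"
    and window': "\<And>u. card (S (Suc t) \<inter> {u..<u + 2 * r (n + Suc t)}) \<le> c'"
    and m: "levels (n + t) \<le> m" "m < levels (n + Suc t)"
  shows "emeasure lebesgue (tower n \<inter> (T ^^ m) -` tower n) \<le>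
    ennreal (w n * real (levels n) * (2 * (real c / real (r (n + t)))
      + 2 * (real c' / real (r (n + Suc t))) + 1 / real (r (n + Suc t))))"
proof -
  define j where "j = n + t"
  define V where "V = w n * real (levels n)"
  have S_bound: "S t' \<subseteq> {..<levels (n + t')}" for t'
    unfolding S by (rule spread_bound) simp
  have S_fin: "finite (S t')" for t'
    unfolding S by (rule finite_spread) simp
  have S_Suc: "S (Suc t') = stack (levels (n + t')) (s (n + t')) (r (n + t')) (S t')" for t'
    unfolding S by simp
  have S_width: "w (n + t') * real (card (S t')) \<le> V" for t'
    unfolding S V_def using width_card_spread_le[of "{..<levels n}" n t'] by simp
  define R where "R = returns (S (t + 2)) m"
  define P where "P = {p \<in> S (t + 2). levels (n + (t + 2)) \<le> p + m}"
  have sub: "tower n \<inter> (T ^^ m) -` tower n \<subseteq> (\<Union>p\<in>R \<union> P. lev (n + (t + 2)) p)"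
  proof
    fix x assume x: "x \<in> tower n \<inter> (T ^^ m) -` tower n"
    then obtain p where p: "p \<in> S (t + 2)" "x \<in> lev (n + (t + 2)) p"
      using tower_eq[of n "t + 2"] S by auto
    show "x \<in> (\<Union>p\<in>R \<union> P. lev (n + (t + 2)) p)"
    proof (cases "levels (n + (t + 2)) \<le> p + m")
      case True
      then show ?thesis
        using p by (auto simp: P_def)
    next
      case False
      then have "(T ^^ m) x \<in> lev (n + (t + 2)) (p + m)"
        using T_power_level p(2) by simp
      moreover obtain p' where p': "p' \<in> S (t + 2)" "(T ^^ m) x \<in> lev (n + (t + 2)) p'"
        using x tower_eq[of n "t + 2"] S by auto
      moreover have "p + m < levels (n + (t + 2))" "p' < levels (n + (t + 2))"
        using False p'(1) S_bound[of "t + 2"] by (simp_all only: not_le lessThan_iff subset_eq)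
      ultimately have "p + m = p'"
        by (intro level_disjoint)
      then show ?thesis
        using p p' by (auto simp: R_def returns_def)
    qed
  qed
  have cross: "card (cross_returns (levels (n + t')) (s (n + t')) (r (n + t')) (S t') m)
      \<le> 2 * card (S t') * b"
    if "\<And>u. card (S t' \<inter> {u..<u + 2 * r (n + t')}) \<le> b" for t' b
    by (rule card_cross_returns_le[OF prime_cuts generator H_ge spacers S_bound that])
  have "card (returns (S (Suc t)) m) \<le> 2 * card (S t) * c"
    using card_returns_stack_le[OF S_bound[of t], of "s (n + t)" "r (n + t)" m]
      returns_empty[OF S_bound m(1)] cross[OF window] by (simp add: S_Suc)
  then have "r (n + Suc t) * card (returns (S (Suc t)) m) \<le> r (n + Suc t) * (2 * card (S t) * c)"
    by (rule mult_le_mono2)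
  moreover have "card R \<le> r (n + Suc t) * card (returns (S (Suc t)) m)
      + card (cross_returns (levels (n + Suc t)) (s (n + Suc t)) (r (n + Suc t)) (S (Suc t)) m)"
    using card_returns_stack_le[OF S_bound[of "Suc t"], of "s (n + Suc t)" "r (n + Suc t)" m]
      S_Suc[of "Suc t"] by (simp only: R_def add_2_eq_Suc')
  ultimately have R_card:
    "card R \<le> r (n + Suc t) * (2 * card (S t) * c) + 2 * card (S (Suc t)) * c'"
    using cross[OF window'] by linarith
  have P_card: "card P \<le> card (S (Suc t))"
    using card_top_stack_le[OF S_bound[of "Suc t"], of m "s (n + Suc t)" "r (n + Suc t)"] m(2)
      levels_Suc[of "n + Suc t"] S_Suc[of "Suc t"] by (simp add: P_def numeral_2_eq_2)
  have "emeasure lebesgue (tower n \<inter> (T ^^ m) -` tower n)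
      \<le> emeasure lebesgue (\<Union>p\<in>R \<union> P. lev (n + (t + 2)) p)"
    using S_fin by (intro emeasure_mono sub sets.finite_UN) (auto simp: R_def P_def returns_def)
  also have "\<dots> \<le> ennreal (w (n + (t + 2)) * real (card (R \<union> P)))"
    using S_fin by (intro emeasure_levels_le) (auto simp: R_def P_def returns_def)
  also have "\<dots> \<le> ennreal (V * (2 * (real c / real (r (n + t)))
      + 2 * (real c' / real (r (n + Suc t))) + 1 / real (r (n + Suc t))))"
  proof (rule ennreal_leI)
    define r0 r1 where "r0 = real (r (n + t))" and "r1 = real (r (n + Suc t))"
    have r_pos: "r0 > 0" "r1 > 0"
      using cuts_pos by (auto simp: r0_def r1_def)
    define w2 where "w2 = w (n + (t + 2))"
    have w2: "w (n + Suc t) = r1 * w2" "w (n + t) = r0 * (r1 * w2)" "w2 > 0"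
      using r_pos width_Suc[of "n + Suc t"] width_Suc[of "n + t"] width_pos'[of "n + (t + 2)"]
      by (simp_all add: w2_def r0_def r1_def)
    define x0 x1 where "x0 = real (card (S t))" and "x1 = real (card (S (Suc t)))"
    have V0: "w2 * r1 * x0 \<le> V / r0" and V1: "w2 * x1 \<le> V / r1"
      using S_width[of t] S_width[of "Suc t"] w2 r_pos
      by (simp_all add: x0_def x1_def field_simps)
    have "card (R \<union> P) \<le> card R + card P"
      by (rule card_Un_le)
    also have "\<dots> \<le> r (n + Suc t) * (2 * card (S t) * c) + 2 * card (S (Suc t)) * c' + card (S (Suc t))"
      using R_card P_card by linarith
    finally have "real (card (R \<union> P)) \<le> r1 * (2 * x0 * real c) + 2 * x1 * real c' + x1"
      unfolding r1_def x0_def x1_def by (metis (no_types, lifting) of_nat_add of_nat_le_iff of_nat_mult of_nat_numeral)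
    then have "w2 * real (card (R \<union> P)) \<le> w2 * (r1 * (2 * x0 * real c) + 2 * x1 * real c' + x1)"
      using w2(3) by (intro mult_left_mono) auto
    also have "\<dots> = (w2 * r1 * x0) * (2 * real c) + (w2 * x1) * (2 * real c' + 1)"
      by (simp add: algebra_simps)
    also have "\<dots> \<le> (V / r0) * (2 * real c) + (V / r1) * (2 * real c' + 1)"
      using V0 V1 by (intro add_mono mult_right_mono) auto
    also have "\<dots> = V * (2 * (real c / r0) + 2 * (real c' / r1) + 1 / r1)"
      by (simp add: algebra_simps add_divide_distrib)
    finally show "w (n + (t + 2)) * real (card (R \<union> P)) \<le> V * (2 * (real c / real (r (n + t)))
      + 2 * (real c' / real (r (n + Suc t))) + 1 / real (r (n + Suc t)))"
      by (simp add: w2_def r0_def r1_def)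
  qed
  finally show ?thesis
    by (simp add: V_def)
qed

text \<open>The intermediate stage \<open>n + t1\<close> is chosen so high that, its tower having large measure, the
  tower of stage \<open>n\<close> occupies a proportion below \<open>\<eta> / 4\<close> of it. A window of length \<open>2 * r\<close> doubles
  this to \<open>\<eta> / 2\<close>, relative to \<open>r\<close>; the other half of \<open>\<eta>\<close> covers the boundary term \<open>3 * K\<close>.\<close>

lemma window_density_small:
  assumes "\<eta> > (0::real)"
  obtains t0 where "\<And>t. t \<ge> t0 \<Longrightarrow> 1 / real (r (n + t)) \<le> \<eta> \<and>
    (\<exists>c. (\<forall>u. card (spread n {..<levels n} t \<inter> {u..<u + 2 * r (n + t)}) \<le> c)
      \<and> real c / real (r (n + t)) \<le> \<eta>)"
proof -
  define V where "V = w n * real (levels n)"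
  have V0: "V > 0"
    using width_pos'[of n] by (simp add: V_def)
  obtain t1 where t1: "w (n + t1) * real (levels (n + t1)) > 4 * V / \<eta>"
    by (rule tower_measure_unbounded)
  define K where "K = card (spread n {..<levels n} t1)"
  define L1 where "L1 = levels (n + t1)"
  have L1_pos: "L1 > 0"
    by (simp add: L1_def)
  have w_pos: "w (n + t1) > 0"
    by (rule width_pos')
  have "w (n + t1) * real K \<le> V"
    using width_card_spread_le[of "{..<levels n}" n t1] by (simp add: K_def V_def)
  also have "V < w (n + t1) * (real L1 * \<eta> / 4)"
    using t1 assms by (simp add: L1_def field_simps)
  finally have density: "2 * real K / real L1 \<le> \<eta> / 2"
    using w_pos L1_pos by (simp add: field_simps)
  have "\<forall>\<^sub>F j in sequentially. nat \<lceil>(6 * real K + 1) / \<eta>\<rceil> \<le> r j"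
    using cuts_at_top by (simp only: filterlim_at_top)
  then obtain j0 where j0: "\<And>j. j \<ge> j0 \<Longrightarrow> nat \<lceil>(6 * real K + 1) / \<eta>\<rceil> \<le> r j"
    unfolding eventually_sequentially by blast
  show ?thesis
  proof (rule that[of "max t1 j0"])
    fix t assume t: "t \<ge> max t1 j0"
    define \<rho> where "\<rho> = r (n + t)"
    have \<rho>: "\<rho> > 0"
      using cuts_pos by (simp add: \<rho>_def)
    have "(6 * real K + 1) / \<eta> \<le> real \<rho>"
      using j0[of "n + t"] t by (simp add: \<rho>_def)
    then have big: "6 * real K + 1 \<le> \<eta> * real \<rho>"
      using assms by (simp add: field_simps)
    define c where "c = (2 * \<rho> div L1 + 3) * K"
    have "card (spread n {..<levels n} t \<inter> {u..<u + 2 * \<rho>}) \<le> c" for u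
      unfolding c_def K_def L1_def by (rule card_spread_window_le) (use t in auto)
    moreover have "real c / real \<rho> \<le> \<eta>"
    proof -
      have "real (2 * \<rho> div L1) \<le> real (2 * \<rho>) / real L1"
        by (rule of_nat_div_le_of_nat)
      then have "real c \<le> (real (2 * \<rho>) / real L1 + 3) * real K"
        unfolding c_def of_nat_mult of_nat_add by (intro mult_right_mono) auto
      also have "\<dots> = (2 * real K / real L1) * real \<rho> + 3 * real K"
        by (simp add: field_simps)
      also have "\<dots> \<le> \<eta> / 2 * real \<rho> + \<eta> * real \<rho> / 2"
        using density big by (intro add_mono mult_right_mono) auto
      finally show ?thesis
        using \<rho> by (simp add: field_simps)
    qed
    moreover have "1 / real \<rho> \<le> \<eta>"
      using big \<rho> by (simp add: field_simps)
    ultimately show "1 / real (r (n + t)) \<le> \<eta> \<and>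
      (\<exists>c. (\<forall>u. card (spread n {..<levels n} t \<inter> {u..<u + 2 * r (n + t)}) \<le> c)
        \<and> real c / real (r (n + t)) \<le> \<eta>)"
      by (auto simp: \<rho>_def)
  qed
qed

lemma towers_return_little:
  assumes "\<epsilon> > (0::real)"
  shows "\<exists>N. \<forall>m>N. emeasure lebesgue (tower n \<inter> (T ^^ m) -` tower n) < ennreal \<epsilon>"
proof -
  define V where "V = w n * real (levels n)"
  have V0: "V > 0"
    using width_pos'[of n] by (simp add: V_def)
  define \<eta> where "\<eta> = \<epsilon> / (6 * V)"
  have "\<eta> > 0"
    using assms V0 by (simp add: \<eta>_def)
  then obtain t0 where t0: "\<And>t. t \<ge> t0 \<Longrightarrow> 1 / real (r (n + t)) \<le> \<eta> \<and>
    (\<exists>c. (\<forall>u. card (spread n {..<levels n} t \<inter> {u..<u + 2 * r (n + t)}) \<le> c)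
      \<and> real c / real (r (n + t)) \<le> \<eta>)"
    by (rule window_density_small[where n = n]) blast
  have "emeasure lebesgue (tower n \<inter> (T ^^ m) -` tower n) < ennreal \<epsilon>" if m: "m > levels (n + t0)" for m
  proof -
    obtain j where j: "n + t0 \<le> j" "levels j \<le> m" "m < levels (Suc j)"
      by (rule stage_of_time[OF less_imp_le[OF m]])
    define t where "t = j - n"
    have t: "j = n + t" "t \<ge> t0"
      using j(1) by (auto simp: t_def)
    obtain c where c: "\<And>u. card (spread n {..<levels n} t \<inter> {u..<u + 2 * r (n + t)}) \<le> c"
      "real c / real (r (n + t)) \<le> \<eta>"
      using t0[OF t(2)] by blast
    obtain c' where c': "\<And>u. card (spread n {..<levels n} (Suc t) \<inter> {u..<u + 2 * r (n + Suc t)}) \<le> c'"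
      "real c' / real (r (n + Suc t)) \<le> \<eta>" "1 / real (r (n + Suc t)) \<le> \<eta>"
      using t0[of "Suc t"] t(2) by (meson le_SucI)
    have "emeasure lebesgue (tower n \<inter> (T ^^ m) -` tower n) \<le>
      ennreal (V * (2 * (real c / real (r (n + t)))
        + 2 * (real c' / real (r (n + Suc t))) + 1 / real (r (n + Suc t))))"
      unfolding V_def
      by (rule emeasure_tower_returns_le[OF refl c(1) c'(1)]) (use j t in auto)
    also have "\<dots> \<le> ennreal (V * (5 * \<eta>))"
      using c(2) c'(2,3) V0 by (intro ennreal_leI mult_left_mono) auto
    also have "\<dots> < ennreal \<epsilon>"
      using V0 assms by (intro ennreal_lessI) (auto simp: \<eta>_def field_simps)
    finally show ?thesis .
  qed
  then show ?thesis
    by blast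
qed

end

theorem mainTheorem3:
  fixes h1 :: nat
    and r :: "nat \<Rightarrow> nat"
    and q :: "nat \<Rightarrow> int"
    and H :: "nat \<Rightarrow> int"
    and s :: "nat \<Rightarrow> nat \<Rightarrow> nat"
    and w :: "nat \<Rightarrow> real"
    and a :: "nat \<Rightarrow> nat \<Rightarrow> real"
    and T :: "real \<Rightarrow> real"
  assumes "\<And>j. prime (r j)"
    and "filterlim r at_top sequentially"
    and "\<And>j. generates_residue_units (int (r j)) (q j)"
    and "\<And>j. H j \<ge> int (r j)"
    and "\<And>j i. i \<in> {1..r j - 1} \<Longrightarrow>
           int (s j i) = H j + q j ^ i mod int (r j) - q j ^ (i + 1) mod int (r j)"
    and "rank_one_construction h1 r s w a T"
    and "emeasure (rank_one_space h1 r s w a) (space (rank_one_space h1 r s w a)) = \<infinity>"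
  shows "infinite_measure_mixing (rank_one_space h1 r s w a) T"
proof -
  interpret rank_one_construction h1 r s w a T
    by (rule assms(6))
  interpret residue_spacer_construction h1 r s w a T q H
    by unfold_locales (use assms in auto)
  show ?thesis
    by (rule mixing_if_towers_return_little[OF width_tendsto_0 towers_return_little])
qed

end
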